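(* Let $\mathbf{R}\in\mathbb{R}^{d\times d}$ be a symmetric positive semi-definite matrix with $\lambda_1(\mathbf{R})>\lambda_d(\mathbf{R})$, let $1\le\kappa_{max}<\kappa(\mathbf{R})$ with $\kappa_{max}$ finite, and let $\mathbf{R}=\mathbf{V}_{\mathbf{R}}\boldsymbol{\Lambda}\mathbf{V}_{\mathbf{R}}^T$ be an eigendecomposition with $\boldsymbol{\Lambda}$ diagonal, $\boldsymbol{\Lambda}(k,k)=\lambda_k(\mathbf{R})$, and $\mathbf{V}_{\mathbf{R}}\in\mathbb{R}^{d\times d}$ a matrix of orthonormal eigenvectors. Let $T=\lambda_1(\mathbf{R})/\kappa_{max}$, let $\boldsymbol{\Gamma}$ be the diagonal matrix with $\boldsymbol{\Gamma}(k,k)=\max\{T-\lambda_k(\mathbf{R}),0\}$, and let $\mathbf{R}_{ME}=\mathbf{V}_{\mathbf{R}}(\boldsymbol{\Lambda}+\boldsymbol{\Gamma})\mathbf{V}_{\mathbf{R}}^T$ be the matrix reconditioned by the minimum eigenvalue method. Let $\boldsymbol{\Sigma}$ and $\boldsymbol{\Sigma}_{ME}$ be the diagonal matrices of standard deviations of $\mathbf{R}$ and $\mathbf{R}_{ME}$ respectively. Then for every $i\in\{1,\dots,d\}$, $$\boldsymbol{\Sigma}_{ME}(i,i)=\left(\mathbf{R}(i,i)+\sum_{k=1}^{d}\mathbf{V}_{\mathbf{R}}(i,k)^2\,\boldsymbol{\Gamma}(k,k)\right)^{1/2},$$ and $$\boldsymbol{\Sigma}(i,i)\le\boldsymbol{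\Sigma}_{ME}(i,i)\le\left(\boldsymbol{\Sigma}(i,i)^2+T-\lambda_d(\mathbf{R})\right)^{1/2}.$$
   Context: Eigenvalues of a symmetric positive semi-definite matrix $\mathbf{S}\in\mathbb{R}^{d\times d}$ are ordered $\lambda_1(\mathbf{S})\ge\dots\ge\lambda_d(\mathbf{S})\ge 0$. The condition number is $\kappa(\mathbf{S})=\lambda_1(\mathbf{S})/\lambda_d(\mathbf{S})$ if $\mathbf{S}$ is positive definite, and $\kappa(\mathbf{S})=\infty$ if $\mathbf{S}$ is singular. The matrix of standard deviations of $\mathbf{S}$ is the diagonal matrix with $(i,i)$ entry $\sqrt{\mathbf{S}(i,i)}$. *)

theory Defs
  imports
    Complex_Main
    "HOL-Library.Extended_Real"
    "HOL-Computational_Algebra.Computational_Algebra"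
    "Jordan_Normal_Form.Char_Poly"
begin

definition sym_mat :: "real mat \<Rightarrow> bool" where
  "sym_mat S \<longleftrightarrow> square_mat S \<and> transpose_mat S = S"

definition pos_semidef :: "real mat \<Rightarrow> bool" where
  "pos_semidef S \<longleftrightarrow> sym_mat S \<and>
     (\<forall>x \<in> carrier_vec (dim_row S). x \<bullet> (S *\<^sub>v x) \<ge> 0)"

definition pos_def :: "real mat \<Rightarrow> bool" where
  "pos_def S \<longleftrightarrow> sym_mat S \<and>
     (\<forall>x \<in> carrier_vec (dim_row S). x \<noteq> 0\<^sub>v (dim_row S) \<longrightarrow> x \<bullet> (S *\<^sub>v x) > 0)"

text \<open>
  \<open>eig S k\<close> is the \<open>k\<close>-th largest eigenvalue, counted with algebraic multiplicity. Like matrix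
  entries it is indexed from 0: for a symmetric matrix of size \<open>d\<close>, the textbook
  \<open>\<lambda>\<^sub>1 \<ge> \<dots> \<ge> \<lambda>\<^sub>d\<close> are \<open>eig S 0, \<dots>, eig S (d - 1)\<close>. The list of
  real eigenvalues has length \<open>d\<close> when \<open>S\<close> is symmetric; for other matrices it may be shorter,
  and indices beyond its length are meaningless.
\<close>

definition eigenvalues_desc :: "real mat \<Rightarrow> real list" where
  "eigenvalues_desc S = rev (sorted_list_of_multiset (proots (char_poly S)))"

definition eig :: "real mat \<Rightarrow> nat \<Rightarrow> real" where
  "eig S k = eigenvalues_desc S ! k"

text \<open>Meant for positive semi-definite \<open>S\<close>, where not positive definite is the same as singular.\<close>

definition cond_number :: "real mat \<Rightarrow> ereal" where
  "cond_number S =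
     (if pos_def S then ereal (eig S 0 / eig S (dim_row S - 1)) else \<infinity>)"

definition stddev_mat :: "real mat \<Rightarrow> real mat" where
  "stddev_mat S = mat_diag (dim_row S) (\<lambda>i. sqrt (S $$ (i, i)))"

text \<open>
  The columns of \<open>V\<close> are orthonormal. (\<open>orthogonal_mat\<close> from the library only
  requires them to be nonzero and pairwise orthogonal.)
\<close>

definition orthonormal_cols :: "real mat \<Rightarrow> bool" where
  "orthonormal_cols V \<longleftrightarrow>
     (\<forall>i < dim_col V. \<forall>j < dim_col V. col V i \<bullet> col V j = (if i = j then 1 else 0))"

end

theory Submission
  imports Defs
begin

text \<open>
  Write \<open>R = V \<Lambda> V\<^sup>T\<close> with \<open>V\<close> orthogonal. Every matrix \<open>V D V\<^sup>T\<close> with \<open>D\<close> diagonal has the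
  diagonal entries \<open>\<Sum>k. V(i,k)\<^sup>2 D(k,k)\<close>, so replacing \<open>\<Lambda>\<close> by \<open>\<Lambda> + \<Gamma>\<close> raises the \<open>i\<close>-th variance by
  \<open>\<Sum>k. V(i,k)\<^sup>2 \<Gamma>(k,k)\<close> (\<open>mult_diag_transpose_index\<close>). The increase is nonnegative because
  \<open>\<Gamma>(k,k) \<ge> 0\<close>. The rows of \<open>V\<close> are unit vectors (\<open>orthonormal_cols_row_sum\<close>), so the increase is a
  weighted mean of the \<open>\<Gamma>(k,k)\<close> and is at most the largest of them.

  It remains to see that \<open>\<Gamma>(k,k) = max (T - \<lambda>\<^sub>k) 0 \<le> T - \<lambda>\<^sub>d\<close>, which needs two facts.
  Firstly, \<open>\<lambda>\<^sub>d \<le> \<lambda>\<^sub>k\<close>: the eigenvalues are entries of a sorted list, but this list enumerates the real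
  roots of the characteristic polynomial, and the index \<open>d - 1\<close> is only meaningful because that
  polynomial splits over the reals. The diagonalization gives the splitting
  (\<open>length_eigenvalues_desc\<close>).
  Secondly, \<open>\<lambda>\<^sub>d \<le> T\<close>: for positive definite \<open>R\<close> this is \<open>\<kappa>_max < \<lambda>\<^sub>1 / \<lambda>\<^sub>d\<close> rearranged; otherwise
  \<open>\<lambda>\<^sub>d \<le> 0 \<le> T\<close>, since a matrix whose eigenvalues are all positive is positive definite
  (\<open>pos_def_of_pos_diag\<close>).
\<close>

section \<open>Orthogonal diagonalization\<close>

lemma orthonormal_cols_inverse:
  assumes V: "V \<in> carrier_mat d d" and ortho: "orthonormal_cols V"
  shows "transpose_mat V * V = 1\<^sub>m d" and "V * transpose_mat V = 1\<^sub>m d"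
proof -
  show left: "transpose_mat V * V = 1\<^sub>m d"
    using assms by (intro eq_matI) (auto simp: orthonormal_cols_def)
  show "V * transpose_mat V = 1\<^sub>m d"
    using mat_mult_left_right_inverse[OF _ V left] V by simp
qed

text \<open>
  For a square matrix, orthonormal columns force orthonormal rows, because a left inverse is also
  a right inverse. These are the weights of the mean that bounds the change in the variances.
\<close>

lemma orthonormal_cols_row_sum:
  assumes V: "V \<in> carrier_mat d d" and ortho: "orthonormal_cols V" and i: "i < d"
  shows "(\<Sum>k<d. (V $$ (i, k))\<^sup>2) = 1"
proof -
  have "(V * transpose_mat V) $$ (i, i) = (\<Sum>k<d. (V $$ (i, k))\<^sup>2)"
    using V i by (simp add: scalar_prod_def power2_eq_square atLeast0LessThan)
  then show ?thesis
    using orthonormal_cols_inverse(2)[OF V ortho] i by simp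
qed

lemma mult_diag_transpose_index:
  fixes V :: "'a::comm_semiring_1 mat"
  assumes V: "V \<in> carrier_mat n d" and i: "i < n"
  shows "(V * mat_diag d f * transpose_mat V) $$ (i, i) = (\<Sum>k<d. (V $$ (i, k))\<^sup>2 * f k)"
  unfolding mat_diag_mult_right[OF V]
  using V i by (simp add: scalar_prod_def power2_eq_square atLeast0LessThan mult_ac)

text \<open>The substitution \<open>y = V\<^sup>T x\<close> turns the quadratic form into \<open>\<Sum>k. f(k) y(k)\<^sup>2\<close>.\<close>

lemma pos_def_of_pos_diag:
  assumes sym: "sym_mat R" and V: "V \<in> carrier_mat d d" and ortho: "orthonormal_cols V"
    and R: "R = V * mat_diag d f * transpose_mat V"
    and pos: "\<And>k. k < d \<Longrightarrow> f k > 0"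
  shows "pos_def R"
  unfolding pos_def_def
proof (intro conjI ballI impI)
  show "sym_mat R" by (fact sym)
next
  fix x :: "real vec" assume x': "x \<in> carrier_vec (dim_row R)" and nz': "x \<noteq> 0\<^sub>v (dim_row R)"
  have x: "x \<in> carrier_vec d" and nz: "x \<noteq> 0\<^sub>v d"
    using x' nz' R V by auto
  define y where "y = transpose_mat V *\<^sub>v x"
  have y: "y \<in> carrier_vec d" using V x by (simp add: y_def)
  have Dy: "mat_diag d f *\<^sub>v y \<in> carrier_vec d"
    by (rule mult_mat_vec_carrier[OF mat_diag_dim y])
  have Dy_index: "(mat_diag d f *\<^sub>v y) $ k = f k * y $ k" if "k < d" for k
  proof -
    have "(mat_diag d f *\<^sub>v y) $ k = (\<Sum>j<d. (if k = j then f j else 0) * y $ j)"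
      using that y by (simp add: mat_diag_def scalar_prod_def atLeast0LessThan)
    also have "\<dots> = (\<Sum>j<d. if k = j then f j * y $ j else 0)"
      by (rule sum.cong) auto
    finally show ?thesis using that by simp
  qed
  have "R *\<^sub>v x = V *\<^sub>v (mat_diag d f *\<^sub>v y)"
  proof -
    have "R *\<^sub>v x = (V * mat_diag d f) *\<^sub>v y"
      unfolding R y_def using V x
      by (intro assoc_mult_mat_vec[where n\<^sub>1 = d and n\<^sub>2 = d and n\<^sub>3 = d]) auto
    also have "\<dots> = V *\<^sub>v (mat_diag d f *\<^sub>v y)"
      by (rule assoc_mult_mat_vec[OF V mat_diag_dim y])
    finally show ?thesis .
  qed
  then have "x \<bullet> (R *\<^sub>v x) = y \<bullet> (mat_diag d f *\<^sub>v y)"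
    unfolding y_def by (simp add: transpose_vec_mult_scalar[OF V Dy[unfolded y_def] x])
  also have "\<dots> = (\<Sum>k<d. f k * (y $ k)\<^sup>2)"
    unfolding scalar_prod_def carrier_vecD[OF Dy] atLeast0LessThan
    by (intro sum.cong refl) (simp add: Dy_index power2_eq_square del: index_mult_mat_vec)
  finally have form: "x \<bullet> (R *\<^sub>v x) = (\<Sum>k<d. f k * (y $ k)\<^sup>2)" .
  have "y \<noteq> 0\<^sub>v d"
  proof
    assume "y = 0\<^sub>v d"
    have "x = (V * transpose_mat V) *\<^sub>v x"
      using orthonormal_cols_inverse(2)[OF V ortho] x by simp
    also have "\<dots> = V *\<^sub>v y"
      unfolding y_def using V x by (intro assoc_mult_mat_vec) auto
    also have "\<dots> = 0\<^sub>v d"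
      unfolding \<open>y = 0\<^sub>v d\<close> using V by (intro eq_vecI) auto
    finally show False using nz by simp
  qed
  then obtain k where k: "k < d" "y $ k \<noteq> 0"
    using y by (metis carrier_vecD eq_vecI index_zero_vec)
  have "0 < (\<Sum>k<d. f k * (y $ k)\<^sup>2)"
    by (rule sum_pos2[where i = k]) (use k pos in \<open>auto simp: less_imp_le\<close>)
  then show "x \<bullet> (R *\<^sub>v x) > 0" by (simp add: form)
qed

lemma eigenvalue_nonneg:
  assumes psd: "pos_semidef R" and ev: "eigenvector R v c" and unit: "v \<bullet> v = 1"
  shows "c \<ge> 0"
proof -
  have "v \<bullet> (R *\<^sub>v v) = c * (v \<bullet> v)"
    using ev by (simp add: eigenvector_def)
  then show ?thesis
    using psd ev unit by (auto simp: pos_semidef_def eigenvector_def)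
qed

lemma eigenvalue_pos:
  assumes pd: "pos_def R" and ev: "eigenvector R v c" and unit: "v \<bullet> v = 1"
  shows "c > 0"
proof -
  have "v \<bullet> (R *\<^sub>v v) = c * (v \<bullet> v)"
    using ev by (simp add: eigenvector_def)
  then show ?thesis
    using pd ev unit by (auto simp: pos_def_def eigenvector_def)
qed

section \<open>The ordered list of eigenvalues\<close>

lemma proots_prod_linear_factors:
  fixes as :: "'a::idom list"
  shows "proots (\<Prod>a \<leftarrow> as. [:- a, 1:]) = mset as"
proof (induction as)
  case (Cons a as)
  have "(\<Prod>a \<leftarrow> as. [:- a, 1:]) \<noteq> 0"
    by (auto simp: prod_list_zero_iff)
  then show ?case
    using Cons.IH by (simp add: proots_mult del: mult_pCons_left)
qed simp

text \<open>
  A diagonalizable matrix has the characteristic polynomial \<open>\<Prod>k. (X - f(k))\<close>, which has \<open>d\<close> roots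
  with multiplicity.
\<close>

lemma length_eigenvalues_desc:
  assumes V: "V \<in> carrier_mat d d" and ortho: "orthonormal_cols V"
    and R: "R = V * mat_diag d f * transpose_mat V"
  shows "length (eigenvalues_desc R) = d"
proof -
  have sim: "similar_mat R (mat_diag d f)"
    by (rule similar_matI[of _ _ V "transpose_mat V" d])
      (use V R orthonormal_cols_inverse[OF V ortho] in auto)
  have "upper_triangular (mat_diag d f)"
    by (auto simp: upper_triangular_def mat_diag_def)
  then have "char_poly R = (\<Prod>a \<leftarrow> diag_mat (mat_diag d f). [:- a, 1:])"
    using char_poly_similar[OF sim] char_poly_upper_triangular[OF mat_diag_dim] by simp
  then have "size (proots (char_poly R)) = length (diag_mat (mat_diag d f))"
    by (simp add: proots_prod_linear_factors)
  then show ?thesis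
    by (simp add: eigenvalues_desc_def diag_mat_def mat_diag_def
        flip: size_mset)
qed

lemma eig_antimono:
  assumes "j \<le> k" and "k < length (eigenvalues_desc R)"
  shows "eig R k \<le> eig R j"
proof -
  have "sorted (rev (eigenvalues_desc R))"
    by (simp add: eigenvalues_desc_def)
  then show ?thesis
    using assms unfolding eig_def by (rule sorted_rev_nth_mono)
qed

section \<open>The minimum eigenvalue method\<close>

text \<open>
  For positive definite \<open>R\<close>, \<open>\<lambda>\<^sub>d > 0\<close> and the bound \<open>\<kappa> < \<lambda>\<^sub>1 / \<lambda>\<^sub>d\<close> can be multiplied out. Otherwise the
  condition number is infinite and its bound says nothing, but then some \<open>\<lambda>\<^sub>k\<close>, and with it \<open>\<lambda>\<^sub>d\<close>, is at
  most \<open>0\<close>, while \<open>\<lambda>\<^sub>1 / \<kappa>\<close> is nonnegative.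
\<close>

lemma min_eig_le_threshold:
  assumes R: "R \<in> carrier_mat d d" and psd: "pos_semidef R" and d: "0 < d"
    and kappa: "1 \<le> \<kappa>" "ereal \<kappa> < cond_number R"
    and V: "V \<in> carrier_mat d d" and ortho: "orthonormal_cols V"
    and ev: "\<forall>k<d. eigenvector R (col V k) (eig R k)"
    and decomp: "R = V * mat_diag d (eig R) * transpose_mat V"
  shows "eig R (d - 1) \<le> eig R 0 / \<kappa>"
proof -
  have unit: "col V k \<bullet> col V k = 1" if "k < d" for k
    using ortho V that by (auto simp: orthonormal_cols_def)
  show ?thesis
  proof (cases "pos_def R")
    case True
    have "\<kappa> < eig R 0 / eig R (d - 1)"
      using kappa(2) R True by (simp add: cond_number_def)
    moreover have "eig R (d - 1) > 0"
      using eigenvalue_pos[OF True _ unit[of "d - 1"]] ev d by simp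
    ultimately show ?thesis
      using kappa(1) by (simp add: field_simps)
  next
    case False
    then obtain k where k: "k < d" "eig R k \<le> 0"
      using pos_def_of_pos_diag[OF _ V ortho decomp] psd
      by (force simp: pos_semidef_def)
    have "eig R (d - 1) \<le> eig R k"
      using k length_eigenvalues_desc[OF V ortho decomp] by (intro eig_antimono) auto
    moreover have "eig R 0 / \<kappa> \<ge> 0"
      using eigenvalue_nonneg[OF psd _ unit[of 0]] ev d kappa(1) by simp
    ultimately show ?thesis using k by linarith
  qed
qed

theorem theorem4:
  fixes d :: nat
    and R V \<Lambda> \<Gamma> R_ME \<Sigma> \<Sigma>_ME :: "real mat"
    and \<kappa>_max T :: real
  assumes R_dim: "R \<in> carrier_mat d d"
    and R_psd: "pos_semidef R"
    and eig_gap: "eig R 0 > eig R (d - 1)"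
    and kappa_ge: "1 \<le> \<kappa>_max"
    and kappa_less: "ereal \<kappa>_max < cond_number R"
    and V_dim: "V \<in> carrier_mat d d"
    and V_orthonormal: "orthonormal_cols V"
    and V_eigenvectors: "\<forall>k<d. eigenvector R (col V k) (eig R k)"
    and Lambda: "\<Lambda> = mat_diag d (\<lambda>k. eig R k)"
    and decomp: "R = V * \<Lambda> * transpose_mat V"
    and T: "T = eig R 0 / \<kappa>_max"
    and Gamma: "\<Gamma> = mat_diag d (\<lambda>k. max (T - eig R k) 0)"
    and R_ME: "R_ME = V * (\<Lambda> + \<Gamma>) * transpose_mat V"
    and Sigma: "\<Sigma> = stddev_mat R"
    and Sigma_ME: "\<Sigma>_ME = stddev_mat R_ME"
  shows "\<forall>i<d.
      \<Sigma>_ME $$ (i, i) = sqrt (R $$ (i, i) + (\<Sum>k<d. (V $$ (i, k))\<^sup>2 * \<Gamma> $$ (k, k))) \<and>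
      \<Sigma> $$ (i, i) \<le> \<Sigma>_ME $$ (i, i) \<and>
      \<Sigma>_ME $$ (i, i) \<le> sqrt ((\<Sigma> $$ (i, i))\<^sup>2 + T - eig R (d - 1))"
proof (intro allI impI)
  fix i assume i: "i < d"
  let ?g = "\<lambda>k. max (T - eig R k) 0"
  define S where "S = (\<Sum>k<d. (V $$ (i, k))\<^sup>2 * ?g k)"
  have decomp': "R = V * mat_diag d (eig R) * transpose_mat V"
    using decomp Lambda by simp
  have sum_diag: "\<Lambda> + \<Gamma> = mat_diag d (\<lambda>k. eig R k + ?g k)"
    unfolding Lambda Gamma by (intro eq_matI) (auto simp: mat_diag_def)

  have R_ii: "R $$ (i, i) = (\<Sum>k<d. (V $$ (i, k))\<^sup>2 * eig R k)"
    by (subst decomp') (rule mult_diag_transpose_index[OF V_dim i])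
  have "R_ME $$ (i, i) = (\<Sum>k<d. (V $$ (i, k))\<^sup>2 * (eig R k + ?g k))"
    unfolding R_ME sum_diag by (rule mult_diag_transpose_index[OF V_dim i])
  then have R_ME_ii: "R_ME $$ (i, i) = R $$ (i, i) + S"
    by (simp add: R_ii S_def sum.distrib distrib_left)
  have Gamma_sum: "(\<Sum>k<d. (V $$ (i, k))\<^sup>2 * \<Gamma> $$ (k, k)) = S"
    unfolding S_def Gamma by (rule sum.cong) (auto simp: mat_diag_def)
  have Sigma_ii: "\<Sigma> $$ (i, i) = sqrt (R $$ (i, i))"
    using R_dim i by (simp add: Sigma stddev_mat_def mat_diag_def)
  have Sigma_ME_ii: "\<Sigma>_ME $$ (i, i) = sqrt (R $$ (i, i) + S)"
    using V_dim i R_ME_ii by (simp add: Sigma_ME stddev_mat_def mat_diag_def R_ME)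

  have len: "length (eigenvalues_desc R) = d"
    by (rule length_eigenvalues_desc[OF V_dim V_orthonormal decomp'])
  have eig_nonneg: "eig R k \<ge> 0" if "k < d" for k
    using eigenvalue_nonneg[OF R_psd, of "col V k"] V_eigenvectors V_orthonormal V_dim that
    by (auto simp: orthonormal_cols_def)
  have R_ii_nonneg: "R $$ (i, i) \<ge> 0"
    unfolding R_ii by (intro sum_nonneg mult_nonneg_nonneg) (auto simp: eig_nonneg)
  have S_nonneg: "S \<ge> 0"
    unfolding S_def by (intro sum_nonneg) auto
  have thr: "eig R (d - 1) \<le> T"
    unfolding T using i
    by (intro min_eig_le_threshold[OF R_dim R_psd _ kappa_ge kappa_less V_dim V_orthonormal
          V_eigenvectors decomp']) auto
  have g_le: "?g k \<le> T - eig R (d - 1)" if "k < d" for k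
    using eig_antimono[of k "d - 1" R] len thr that by auto
  have "S \<le> (\<Sum>k<d. (V $$ (i, k))\<^sup>2 * (T - eig R (d - 1)))"
    unfolding S_def by (intro sum_mono mult_left_mono g_le) auto
  also have "\<dots> = T - eig R (d - 1)"
    by (simp add: orthonormal_cols_row_sum[OF V_dim V_orthonormal i] flip: sum_distrib_right)
  finally have S_le: "S \<le> T - eig R (d - 1)" .

  show "\<Sigma>_ME $$ (i, i) = sqrt (R $$ (i, i) + (\<Sum>k<d. (V $$ (i, k))\<^sup>2 * \<Gamma> $$ (k, k))) \<and>
      \<Sigma> $$ (i, i) \<le> \<Sigma>_ME $$ (i, i) \<and>
      \<Sigma>_ME $$ (i, i) \<le> sqrt ((\<Sigma> $$ (i, i))\<^sup>2 + T - eig R (d - 1))"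
    using R_ii_nonneg S_nonneg S_le by (simp add: Sigma_ii Sigma_ME_ii Gamma_sum)
qed

end
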